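(* Let $(S_n)_{n\ge 0}$ be the Dynamic Elephant Random Walk with parameters $p,q\in[0,1]$, weights $\alpha_n=g(\alpha,n)$, dynamical system $(\mathcal{X},\mathscr{A},\mu,T)$ and function $f$. Suppose that $p\cdot \ell_{\sup}(\alpha)<1$, where $\ell_{\sup}(\alpha)=\limsup_{n\to\infty} g(\alpha,n)$. Then for every $x\in\mathcal{X}$, $$\frac{S_n-\mathbb{E}_x[S_n]}{n}\to 0\quad \text{as } n\to\infty,\qquad \mathbb{P}_x\text{-almost surely}.$$
   Context: Dynamic Elephant Random Walk (DERW). Let $(\mathcal{X},\mathscr{A},\mu)$ be a probability space and $T:\mathcal{X}\to\mathcal{X}$ a measurable $\mu$-preserving map ($\mu(T^{-1}A)=\mu(A)$ for all $A\in\mathscr{A}$); $T^n$ denotes the $n$-fold iterate. Let $f:\mathcal{X}\to[0,1]$ be $\mathscr{A}$-measurable. Let $p,q\in[0,1]$, let $g:R\subset\mathbb{R}\times\mathbb{N}\to[0,1]$ be a function and fix $\alpha\in\mathbb{R}$ with $(\alpha,n)\in R$ for all $n\ge1$; write $\alpha_n:=g(\alpha,n)\in[0,1]$. For $x\in\mathcal{X}$, the DERW under the probability $\mathbb{P}_x$ (expectation $\mathbb{E}_x$) is the process $S_0=0$, $S_n=\sum_{i=1}^n X_i$, with $\{-1,1\}$-valued increments such that $\mathbb{P}_x[X_1=1]=\alpha_1 q+(1-\alpha_1)f(Tx)$ and, for $n\ge1$, $\eta\in\{-1,1\}$, with $\mathscr{F}_n=\sigma(X_1,\dots,X_n)$,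 $$\mathbb{P}_x[X_{n+1}=\eta\mid\mathscr{F}_n]=\alpha_{n+1}\,\frac{1}{2n}\sum_{k=1}^{n}\bigl(1+(2p-1)X_k\eta\bigr)+(1-\alpha_{n+1})\,d_{n+1}(\eta),$$ where $d_m(1)=f(T^m x)$ and $d_m(-1)=1-f(T^m x)$. Standing assumption: the case where both $g(\alpha,2)=1$ and $p=0$ is excluded. *)

theory Defs
  imports "HOL-Probability.Probability"
begin

definition measure_preserving_map :: "'a measure \<Rightarrow> ('a \<Rightarrow> 'a) \<Rightarrow> bool" where
  "measure_preserving_map M T \<longleftrightarrow>
     T \<in> measurable M M \<and>
     (\<forall>A\<in>sets M. emeasure M (T -` A \<inter> space M) = emeasure M A)"

locale derw_parameters = prob_space M
  for M :: "'a measure" +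
  fixes T :: "'a \<Rightarrow> 'a" and f :: "'a \<Rightarrow> real" and p q :: real
    and R :: "(real \<times> nat) set" and g :: "real \<times> nat \<Rightarrow> real" and \<alpha> :: real
  assumes T: "measure_preserving_map M T"
    and f_measurable: "f \<in> borel_measurable M"
    and f_range: "f \<in> space M \<rightarrow> {0..1}"
    and p: "p \<in> {0..1}"
    and q: "q \<in> {0..1}"
    and g: "g \<in> R \<rightarrow> {0..1}"
    and \<alpha>: "\<And>n. n \<ge> 1 \<Longrightarrow> (\<alpha>, n) \<in> R"
    and nondegenerate: "\<not> (g (\<alpha>, 2) = 1 \<and> p = 0)"

(* The probability d_m(\<eta>); it is only meant for \<eta> = 1 and \<eta> = -1. *)
definition dyn_prob :: "('a \<Rightarrow> 'a) \<Rightarrow> ('a \<Rightarrow> real) \<Rightarrow> 'a \<Rightarrow> nat \<Rightarrow> real \<Rightarrow> real" where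
  "dyn_prob T f x m \<eta> = (if \<eta> = 1 then f ((T ^^ m) x) else 1 - f ((T ^^ m) x))"

(* The sigma-algebra on the sample space generated by X 1, ..., X n. *)
definition history :: "'w measure \<Rightarrow> (nat \<Rightarrow> 'w \<Rightarrow> real) \<Rightarrow> nat \<Rightarrow> 'w measure" where
  "history P X n = sigma (space P) {X k -` B \<inter> space P | k B. k \<in> {1..n} \<and> B \<in> sets borel}"

(* Under P, the sequence X 1, X 2, ... is the increment sequence of the walk started
   from the point x; the value X 0 is irrelevant. Conditional probabilities are conditional
   expectations of indicators, determined up to P-null sets. *)
locale derw_increments = prob_space P
  for P :: "'w measure" +
  fixes T :: "'a \<Rightarrow> 'a" and f :: "'a \<Rightarrow> real" and p q :: real
    and g :: "real \<times> nat \<Rightarrow> real" and \<alpha> :: real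
    and x :: 'a and X :: "nat \<Rightarrow> 'w \<Rightarrow> real"
  assumes X_measurable: "\<And>n. n \<ge> 1 \<Longrightarrow> X n \<in> borel_measurable P"
    and X_values: "\<And>n \<omega>. n \<ge> 1 \<Longrightarrow> \<omega> \<in> space P \<Longrightarrow> X n \<omega> \<in> {-1, 1}"
    and X_first: "measure P {\<omega> \<in> space P. X 1 \<omega> = 1} = g (\<alpha>, 1) * q + (1 - g (\<alpha>, 1)) * f (T x)"
    and X_step: "\<And>n \<eta>. n \<ge> 1 \<Longrightarrow> \<eta> \<in> {-1, 1} \<Longrightarrow>
      AE \<omega> in P.
        real_cond_exp P (history P X n) (indicator {\<omega> \<in> space P. X (n + 1) \<omega> = \<eta>}) \<omega> =
          g (\<alpha>, n + 1) * (1 / (2 * real n)) * (\<Sum>k=1..n. 1 + (2 * p - 1) * X k \<omega> * \<eta>)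
          + (1 - g (\<alpha>, n + 1)) * dyn_prob T f x (n + 1) \<eta>"

definition walk :: "(nat \<Rightarrow> 'w \<Rightarrow> real) \<Rightarrow> nat \<Rightarrow> 'w \<Rightarrow> real" where
  "walk X n \<omega> = (\<Sum>i=1..n. X i \<omega>)"

(* Extended-real valued because limsup needs a complete linear order. *)
definition ell_sup :: "(real \<times> nat \<Rightarrow> real) \<Rightarrow> real \<Rightarrow> ereal" where
  "ell_sup g \<alpha> = limsup (\<lambda>n. ereal (g (\<alpha>, n)))"

end

theory Submission
  imports Defs
begin

text \<open>Let \<open>W n\<close> be the centred walk and \<open>V n\<close> its second moment. The conditional law of the
  increments gives \<open>V (n+1) \<le> (1 + 2 c / n) V n + 4\<close> for large \<open>n\<close>, where \<open>c < 1\<close> bounds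
  \<open>g (\<alpha>, n) (2 p - 1)\<close> eventually: for \<open>p < 1\<close> automatically, for \<open>p = 1\<close> by the limsup hypothesis.
  Hence \<open>\<Sum> V n / n\<^sup>3 < \<infinity>\<close>, so for \<open>U n = W n / n\<close> the series \<open>\<Sum> (U n)\<^sup>2 / n\<close> converges almost surely.
  As \<open>U (n+1) - U n = O(1/n)\<close>, the increments of \<open>U\<^sup>3\<close> are absolutely summable, so \<open>U\<close> converges,
  and divergence of the harmonic series leaves \<open>0\<close> as the only possible limit.\<close>

section \<open>Deterministic recursions and series\<close>

text \<open>The weights are chosen so that the factors of \<open>v'\<close> on the left add up to
  \<open>(n + 3) / (n + 1)^3\<close>, free of \<open>c\<close>. This is below \<open>1 / n^2\<close>
  because \<open>(n + 1)^3 - n^2 * (n + 3) = 3 * n + 1\<close>.\<close>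

lemma lyapunov_step:
  fixes n c K v v' :: real
  assumes n: "n \<ge> 1" and v': "v' \<ge> 0" and step: "v' \<le> (1 + 2 * c / n) * v + K"
  shows "v' / (n + 1)^2 * (1 + 2 * c / (n + 1)) + (2 - 2 * c) * (v' / (n + 1)^3)
    \<le> v / n^2 * (1 + 2 * c / n) + K / n^2"
proof -
  have "v' / (n + 1)^2 * (1 + 2 * c / (n + 1)) + (2 - 2 * c) * (v' / (n + 1)^3) = v' * ((n + 3) / (n + 1)^3)"
    using n by (simp add: divide_simps power2_eq_square power3_eq_cube) (simp add: algebra_simps)
  also have "n^2 * (n + 3) \<le> (n + 1)^3"
    using n by (simp add: power2_eq_square power3_eq_cube algebra_simps)
  hence "(n + 3) / (n + 1)^3 \<le> 1 / n^2"
    using n by (simp add: field_simps)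
  hence "v' * ((n + 3) / (n + 1)^3) \<le> v' * (1 / n^2)"
    using v' by (intro mult_left_mono)
  also have "\<dots> \<le> ((1 + 2 * c / n) * v + K) * (1 / n^2)"
    using step by (intro mult_right_mono) auto
  also have "\<dots> = v / n^2 * (1 + 2 * c / n) + K / n^2"
    by (simp add: add_divide_distrib mult.commute)
  finally show ?thesis .
qed

text \<open>The potential \<open>z\<close> loses a positive multiple of the next series term at each
  step, up to an error \<open>K / n^2\<close>; since \<open>2 - 2 * c > 0\<close> and the errors are
  summable, telescoping bounds the partial sums.\<close>

lemma summable_of_recursive_bound:
  fixes V :: "nat \<Rightarrow> real" and c K :: real and N :: nat
  assumes c: "0 \<le> c" "c < 1" and V: "\<And>n. V n \<ge> 0" and K: "K \<ge> 0"
    and step: "\<And>n. n \<ge> N \<Longrightarrow> V (Suc n) \<le> (1 + 2 * c / real n) * V n + K"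
  shows "summable (\<lambda>n. V n / real n ^ 3)"
proof -
  define z where "z n = V n / real n^2 * (1 + 2 * c / real n)" for n
  \<comment> \<open>The shift keeps every index at least 1, as \<open>lyapunov_step\<close>
    requires.\<close>
  define N' where "N' = Suc N"
  let ?s = "\<lambda>k. V (Suc (k + N')) / real (Suc (k + N')) ^ 3"
  have z0: "z n \<ge> 0" for n using V c by (simp add: z_def)
  have zstep: "z (Suc n) + (2 - 2 * c) * (V (Suc n) / real (Suc n)^3) \<le> z n + K / real n^2"
    if "n \<ge> N'" for n
    using lyapunov_step[of "real n" "V (Suc n)" c "V n" K] step[of n] V[of "Suc n"] that
    by (simp add: z_def N'_def add.commute)
  have sq: "summable (\<lambda>n. K / real n^2)"
    using summable_mult[OF inverse_power_summable[of 2, where 'a=real], of K] 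
    by (simp add: field_simps)
  have tele: "z (m + N') + (2 - 2 * c) * (\<Sum>k<m. ?s k) \<le> z N' + (\<Sum>k<m. K / real (k + N')^2)" for m
  proof (induction m)
    case (Suc m)
    then show ?case using zstep[of "m + N'"] by (simp add: algebra_simps)
  qed simp
  have "summable ?s"
  proof (rule summableI_nonneg_bounded)
    fix m
    have "summable (\<lambda>k. K / real (k + N')^2)"
      using sq by (subst summable_iff_shift)
    then have "(\<Sum>k<m. K / real (k + N')^2) \<le> (\<Sum>k. K / real (k + N')^2)"
      using K by (intro sum_le_suminf) auto
    then have "(2 - 2 * c) * (\<Sum>k<m. ?s k) \<le> z N' + (\<Sum>k. K / real (k + N')^2)"
      using tele[of m] z0[of "m + N'"] by linarith
    then show "(\<Sum>k<m. ?s k) \<le> (z N' + (\<Sum>k. K / real (k + N')^2)) / (2 - 2 * c)"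
      using c by (simp add: field_simps)
  qed (use V in simp)
  then show ?thesis
    using summable_iff_shift[of "\<lambda>n. V n / real n ^ 3" "Suc N'"] by simp
qed

text \<open>Increments of order \<open>1/n\<close> need not be summable, but an increment of the
  cube carries an extra quadratic factor in \<open>u\<close>, which the weighted series
  controls.\<close>

lemma tendsto_zero_of_summable_weighted_squares:
  fixes u :: "nat \<Rightarrow> real"
  assumes sum: "summable (\<lambda>n. u n ^ 2 / real n)"
    and incr: "\<And>n. n \<ge> 1 \<Longrightarrow> \<bar>u (Suc n) - u n\<bar> \<le> C / real n"
  shows "u \<longlonglongrightarrow> 0"
proof -
  have C: "C \<ge> 0" using incr[of 1] by simp
  have sumS: "summable (\<lambda>n. u (Suc n) ^ 2 / real (Suc n))"
    using sum by (subst summable_Suc_iff)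
  have cube: "\<bar>u (Suc n) ^ 3 - u n ^ 3\<bar>
      \<le> C * 3 / 2 * (u n ^ 2 / real n) + C * 3 * (u (Suc n) ^ 2 / real (Suc n))" if n: "n \<ge> 1" for n
  proof -
    let ?a = "u (Suc n)" and ?b = "u n"
    have "?a ^ 3 - ?b ^ 3 = (?a - ?b) * (?a^2 + ?a * ?b + ?b^2)"
      by (simp add: power2_eq_square power3_eq_cube algebra_simps)
    moreover have "\<bar>?a^2 + ?a * ?b + ?b^2\<bar> \<le> 3 / 2 * (?a^2 + ?b^2)"
      using sum_squares_bound[of ?a ?b] sum_squares_bound[of ?a "-?b"]
      by (simp add: abs_le_iff)
    ultimately have "\<bar>?a ^ 3 - ?b ^ 3\<bar> \<le> C / real n * (3 / 2 * (?a^2 + ?b^2))"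
      using incr[OF n] C unfolding \<open>?a ^ 3 - ?b ^ 3 = _\<close> abs_mult by (intro mult_mono) auto
    also have "\<dots> = C * 3 / 2 * (?b^2 / real n) + C * 3 / 2 * (?a^2 * (1 / real n))"
      by (simp add: add_divide_distrib algebra_simps)
    \<comment> \<open>Matching the weight of the square at \<open>Suc n\<close> to the shifted
      series costs a factor 2, turning \<open>C * 3 / 2\<close> into \<open>C * 3\<close>.\<close>
    also have "1 / real n \<le> 2 / real (Suc n)"
      using n by (simp add: field_simps)
    hence "C * 3 / 2 * (?a^2 * (1 / real n)) \<le> C * 3 / 2 * (?a^2 * (2 / real (Suc n)))"
      using C by (intro mult_left_mono) auto
    finally show ?thesis by (simp add: field_simps)
  qed
  have "summable (\<lambda>n. u (Suc n) ^ 3 - u n ^ 3)"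
    by (rule summable_comparison_test[OF _
          summable_add[OF summable_mult[OF sum, of "C * 3 / 2"] summable_mult[OF sumS, of "C * 3"]]])
       (use cube in \<open>unfold real_norm_def, blast\<close>)
  then have "convergent (\<lambda>n. \<Sum>k<n. u (Suc k) ^ 3 - u k ^ 3)"
    by (simp add: summable_iff_convergent)
  then obtain l where "(\<lambda>n. u n ^ 3 - u 0 ^ 3) \<longlonglongrightarrow> l"
    by (auto simp: convergent_def sum_lessThan_telescope[of "\<lambda>k. u k ^ 3"])
  from tendsto_add[OF this tendsto_const[of "u 0 ^ 3"]]
  have "(\<lambda>n. u n ^ 3) \<longlonglongrightarrow> l + u 0 ^ 3" by simp
  \<comment> \<open>The odd root inverts the cube on all reals, so the sign of \<open>u\<close> does
    not matter.\<close>
  from tendsto_real_root[OF this, of 3]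
  have lim: "u \<longlonglongrightarrow> root 3 (l + u 0 ^ 3)" (is "_ \<longlonglongrightarrow> ?L")
    by (simp add: odd_real_root_power_cancel)
  have "?L = 0"
  proof (rule ccontr)
    assume "?L \<noteq> 0"
    \<comment> \<open>A nonzero limit would make the weighted series dominate a positive multiple of
      the harmonic series.\<close>
    have "eventually (\<lambda>n. u n ^ 2 > ?L^2 / 2) sequentially"
      by (rule order_tendstoD(1)[OF tendsto_power[OF lim]]) (use \<open>?L \<noteq> 0\<close> in simp)
    then have "eventually (\<lambda>n. norm (?L^2 / 2 * (1 / real n)) \<le> u n ^ 2 / real n) sequentially"
      by eventually_elim (auto simp: divide_simps)
    then have "summable (\<lambda>n. ?L^2 / 2 * (1 / real n))"
      by (rule summable_comparison_test_ev) (rule sum)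
    then have "summable (\<lambda>n. 1 / real n)"
      using \<open>?L \<noteq> 0\<close> by (subst (asm) summable_cmult_iff) simp
    then show False
      using not_summable_harmonic[where 'a=real] by (simp add: inverse_eq_divide)
  qed
  then show ?thesis using lim by simp
qed

section \<open>Almost sure summability, expectation and drift bounds\<close>

text \<open>By monotone convergence the sum of the \<open>Z n\<close> has finite integral, hence is
  finite almost everywhere.\<close>

lemma (in prob_space) AE_summable_of_summable_expectation:
  fixes Z :: "nat \<Rightarrow> 'a \<Rightarrow> real"
  assumes int: "\<And>n. integrable M (Z n)" and nn: "\<And>n \<omega>. Z n \<omega> \<ge> 0"
    and sum: "summable (\<lambda>n. expectation (Z n))"
  shows "AE \<omega> in M. summable (\<lambda>n. Z n \<omega>)"
proof -
  have [measurable]: "Z n \<in> borel_measurable M" for n using int by auto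
  have "(\<integral>\<^sup>+\<omega>. (\<Sum>n. ennreal (Z n \<omega>)) \<partial>M) = (\<Sum>n. ennreal (expectation (Z n)))"
    using int nn by (simp add: nn_integral_suminf nn_integral_eq_integral)
  also have "\<dots> \<noteq> \<infinity>"
    using sum nn by (simp add: suminf_ennreal2)
  finally have "AE \<omega> in M. (\<Sum>n. ennreal (Z n \<omega>)) \<noteq> \<infinity>"
    by (intro nn_integral_PInf_AE) auto
  then show ?thesis
    by eventually_elim (use nn in \<open>auto intro: summable_suminf_not_top\<close>)
qed

lemma (in prob_space) abs_expectation_le:
  fixes Z :: "'a \<Rightarrow> real"
  assumes "\<And>\<omega>. \<omega> \<in> space M \<Longrightarrow> \<bar>Z \<omega>\<bar> \<le> c" "integrable M Z"
  shows "\<bar>expectation Z\<bar> \<le> c"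
proof -
  have "\<bar>expectation Z\<bar> \<le> expectation (\<lambda>\<omega>. \<bar>Z \<omega>\<bar>)"
    using integral_norm_bound[of M Z] by simp
  also have "\<dots> \<le> expectation (\<lambda>\<omega>. c)"
    using assms by (intro integral_mono) auto
  finally show ?thesis by (simp add: prob_space)
qed

text \<open>For \<open>p < 1\<close> the factor \<open>2 * p - 1\<close> is itself below 1 and
  \<open>g n\<close> is at most 1; for \<open>p = 1\<close> that factor is 1 and the limsup
  condition separates \<open>g\<close> from 1 eventually.\<close>

lemma drift_bound:
  fixes g :: "nat \<Rightarrow> real"
  assumes p: "0 \<le> p" "p \<le> 1" and g: "\<And>n. n \<ge> 1 \<Longrightarrow> 0 \<le> g n \<and> g n \<le> 1"
    and sup: "ereal p * limsup (\<lambda>n. ereal (g n)) < 1"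
  obtains c N where "0 \<le> c" "c < 1" "\<And>n. n \<ge> N \<Longrightarrow> g n * (2 * p - 1) \<le> c"
proof (cases "p = 1")
  case True
  then have "limsup (\<lambda>n. ereal (g n)) < 1" using sup by (simp flip: one_ereal_def)
  then obtain c where c: "limsup (\<lambda>n. ereal (g n)) < ereal c" "ereal c < 1"
    using ereal_dense2 by blast
  from Limsup_lessD[OF c(1)] obtain N where N: "\<And>n. n \<ge> N \<Longrightarrow> g n < c"
    by (auto simp: eventually_sequentially)
  \<comment> \<open>\<open>Suc N\<close> rather than \<open>N\<close>, since the lower bound on
    \<open>g\<close> starts at index 1.\<close>
  have "0 \<le> c" using g[of "Suc N"] N[of "Suc N"] by simp
  then show thesis using that[of c N] N c True by (force simp: one_ereal_def)
next
  case False
  show thesis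
  proof (rule that[of "max 0 (2 * p - 1)" 1])
    fix n :: nat assume "n \<ge> 1"
    then show "g n * (2 * p - 1) \<le> max 0 (2 * p - 1)"
      using g[of n] mult_right_mono[of "g n" 1 "2 * p - 1"] mult_nonneg_nonpos[of "g n" "2 * p - 1"]
      by (cases "2 * p - 1 \<ge> 0") auto
  qed (use p False in auto)
qed

section \<open>Histories and the centred walk\<close>

context derw_increments
begin

lemma space_history [simp]: "space (history P X n) = space P"
  by (simp add: history_def space_measure_of_conv)

lemma sets_history:
  "sets (history P X n)
    = sigma_sets (space P) {X k -` B \<inter> space P | k B. k \<in> {1..n} \<and> B \<in> sets borel}"
  unfolding history_def by (rule sets_measure_of) auto

lemma subalgebra_history: "subalgebra P (history P X n)"
  unfolding subalgebra_def sets_history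
  using X_measurable by (auto intro!: sets.sigma_sets_subset)

lemma X_measurable_history:
  assumes "k \<in> {1..n}"
  shows "X k \<in> borel_measurable (history P X n)"
proof (rule measurableI)
  fix B :: "real set" assume "B \<in> sets borel"
  then show "X k -` B \<inter> space (history P X n) \<in> sets (history P X n)"
    unfolding sets_history space_history using assms by (intro sigma_sets.Basic) blast
qed simp

lemma walk_measurable_history: "walk X n \<in> borel_measurable (history P X n)"
  unfolding walk_def using X_measurable_history by (intro borel_measurable_sum) auto

lemma walk_measurable [measurable]: "walk X n \<in> borel_measurable P"
  using measurable_from_subalg[OF subalgebra_history walk_measurable_history] .

lemma abs_walk_le: "\<omega> \<in> space P \<Longrightarrow> \<bar>walk X n \<omega>\<bar> \<le> real n"
proof -
  assume "\<omega> \<in> space P"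
  then have "\<bar>walk X n \<omega>\<bar> \<le> (\<Sum>i=1..n. 1)"
    unfolding walk_def using X_values by (intro order_trans[OF sum_abs] sum_mono) fastforce
  then show ?thesis by simp
qed

lemma integrable_walk: "integrable P (walk X n)"
  by (rule integrable_const_bound[of _ "real n"]) (use abs_walk_le in auto)

lemma walk_Suc: "walk X (Suc n) \<omega> = walk X n \<omega> + X (Suc n) \<omega>"
  by (simp add: walk_def)

lemma X_measurable_Suc [measurable]: "X (Suc n) \<in> borel_measurable P"
  by (rule X_measurable) simp

lemma abs_X_Suc: "\<omega> \<in> space P \<Longrightarrow> \<bar>X (Suc n) \<omega>\<bar> = 1"
  using X_values[of "Suc n" \<omega>] by auto

lemma integrable_X_Suc: "integrable P (X (Suc n))"
  by (rule integrable_const_bound[of _ 1]) (auto simp: abs_X_Suc)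

definition cwalk :: "nat \<Rightarrow> 'w \<Rightarrow> real" where
  "cwalk n \<omega> = walk X n \<omega> - expectation (walk X n)"

lemma cwalk_measurable [measurable]: "cwalk n \<in> borel_measurable P"
  unfolding cwalk_def by measurable

lemma cwalk_measurable_history: "cwalk n \<in> borel_measurable (history P X n)"
  unfolding cwalk_def using walk_measurable_history by measurable

lemma abs_cwalk_le: "\<omega> \<in> space P \<Longrightarrow> \<bar>cwalk n \<omega>\<bar> \<le> 2 * real n"
  using abs_walk_le[of \<omega> n] abs_expectation_le[OF abs_walk_le integrable_walk, of n]
  unfolding cwalk_def by linarith

lemma integrable_cwalk: "integrable P (cwalk n)"
  by (rule integrable_const_bound[of _ "2 * real n"]) (use abs_cwalk_le in auto)

lemma integrable_cwalk_mult:
  assumes [measurable]: "Z \<in> borel_measurable P" and "\<And>\<omega>. \<omega> \<in> space P \<Longrightarrow> \<bar>Z \<omega>\<bar> \<le> c"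
  shows "integrable P (\<lambda>\<omega>. cwalk n \<omega> * Z \<omega>)"
  by (rule integrable_const_bound[of _ "2 * real n * c"])
     (use assms(2) abs_cwalk_le in \<open>auto simp: abs_mult intro!: mult_mono\<close>)

lemma integrable_cwalk_sq: "integrable P (\<lambda>\<omega>. cwalk n \<omega> ^ 2)"
  unfolding power2_eq_square by (rule integrable_cwalk_mult[OF _ abs_cwalk_le]) auto

lemma expectation_cwalk: "expectation (cwalk n) = 0"
  unfolding cwalk_def using integrable_walk by (simp add: prob_space)

lemma cwalk_Suc: "cwalk (Suc n) \<omega> = cwalk n \<omega> + (X (Suc n) \<omega> - expectation (X (Suc n)))"
  using integrable_walk integrable_X_Suc by (simp add: cwalk_def walk_Suc[abs_def])

lemma abs_centered_X_le: "\<omega> \<in> space P \<Longrightarrow> \<bar>X (Suc n) \<omega> - expectation (X (Suc n))\<bar> \<le> 2"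
  using abs_X_Suc[of \<omega> n] abs_expectation_le[of "X (Suc n)" 1] integrable_X_Suc[of n] abs_X_Suc[of _ n]
    abs_triangle_ineq4[of "X (Suc n) \<omega>" "expectation (X (Suc n))"]
  by simp

text \<open>Given the history, the probability of an up-step is affine in the walk. The constant
  part, including the dynamical term, vanishes against the centred walk, so only the memory slope
  survives.\<close>

lemma expectation_cwalk_mult_X:
  assumes n: "n \<ge> 1"
  shows "expectation (\<lambda>\<omega>. cwalk n \<omega> * X (Suc n) \<omega>)
    = g (\<alpha>, Suc n) * (2 * p - 1) / real n * expectation (\<lambda>\<omega>. cwalk n \<omega> ^ 2)"
proof -
  interpret H: finite_measure_subalgebra P "history P X n"
    by unfold_locales (rule subalgebra_history)
  define A where "A = {\<omega> \<in> space P. X (n + 1) \<omega> = 1}"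
  \<comment> \<open>Slope \<open>b\<close> and intercept \<open>k\<close> of the conditional
    probability as a function of \<open>cwalk n\<close>; \<open>k\<close> also absorbs the mean of
    the walk.\<close>
  define b where "b = g (\<alpha>, Suc n) * (2 * p - 1) / (2 * real n)"
  define k where "k = g (\<alpha>, Suc n) / 2 + (1 - g (\<alpha>, Suc n)) * dyn_prob T f x (Suc n) 1
    + b * expectation (walk X n)"
  have A[measurable]: "A \<in> sets P" unfolding A_def by simp
  have ind: "integrable P (\<lambda>\<omega>. cwalk n \<omega> * indicator A \<omega>)"
    by (rule integrable_cwalk_mult[of _ 1]) (auto split: split_indicator)
  have cond: "AE \<omega> in P. real_cond_exp P (history P X n) (indicator A) \<omega> = b * cwalk n \<omega> + k"
    using X_step[OF n, of 1, folded A_def, OF insertI2[OF singletonI]]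
  proof eventually_elim
    case (elim \<omega>)
    have "(\<Sum>k=1..n. 1 + (2 * p - 1) * X k \<omega> * 1) = real n + (2 * p - 1) * walk X n \<omega>"
      by (simp add: sum.distrib walk_def sum_distrib_left)
    then have "real_cond_exp P (history P X n) (indicator A) \<omega>
        = g (\<alpha>, Suc n) * (1 / (2 * real n)) * (real n + (2 * p - 1) * walk X n \<omega>)
          + (1 - g (\<alpha>, Suc n)) * dyn_prob T f x (Suc n) 1"
      using elim by simp
    also have "\<dots> = b * cwalk n \<omega> + k"
      using n by (simp add: b_def k_def cwalk_def field_simps)
    finally show ?case .
  qed
  \<comment> \<open>As \<open>cwalk n\<close> is history-measurable, the indicator may be replaced
    by its conditional expectation.\<close>
  have "expectation (\<lambda>\<omega>. cwalk n \<omega> * indicator A \<omega>)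
      = expectation (\<lambda>\<omega>. cwalk n \<omega> * real_cond_exp P (history P X n) (indicator A) \<omega>)"
    using H.real_cond_exp_intg(2)[OF ind cwalk_measurable_history] by simp
  also have "\<dots> = expectation (\<lambda>\<omega>. b * cwalk n \<omega> ^ 2 + k * cwalk n \<omega>)"
    using cond by (intro integral_cong_AE) (auto simp: power2_eq_square algebra_simps)
  also have "\<dots> = b * expectation (\<lambda>\<omega>. cwalk n \<omega> ^ 2)"
    using integrable_cwalk integrable_cwalk_sq by (simp add: expectation_cwalk)
  finally have E: "expectation (\<lambda>\<omega>. cwalk n \<omega> * indicator A \<omega>) = \<dots>" .
  \<comment> \<open>A sign is twice the indicator of its value 1, minus 1.\<close>
  have "expectation (\<lambda>\<omega>. cwalk n \<omega> * X (Suc n) \<omega>)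
      = expectation (\<lambda>\<omega>. 2 * (cwalk n \<omega> * indicator A \<omega>) - cwalk n \<omega>)"
    using X_values[of "Suc n"] by (intro Bochner_Integration.integral_cong) (force simp: A_def split: split_indicator)+
  also have "\<dots> = 2 * (b * expectation (\<lambda>\<omega>. cwalk n \<omega> ^ 2))"
    using ind integrable_cwalk by (simp add: expectation_cwalk E)
  finally show ?thesis by (simp add: b_def)
qed

text \<open>Expand the square of \<open>cwalk n\<close> plus a centred increment: the cross term is
  given by \<open>expectation_cwalk_mult_X\<close>, the mean \<open>m\<close> pairs to zero with
  \<open>cwalk n\<close>, and the squared increment is at most \<open>2^2 = 4\<close>.\<close>

lemma second_moment_step:
  assumes n: "n \<ge> 1"
  shows "expectation (\<lambda>\<omega>. cwalk (Suc n) \<omega> ^ 2)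
    \<le> (1 + 2 * (g (\<alpha>, Suc n) * (2 * p - 1)) / real n) * expectation (\<lambda>\<omega>. cwalk n \<omega> ^ 2) + 4"
proof -
  define m where "m = expectation (X (Suc n))"
  have int: "integrable P (\<lambda>\<omega>. cwalk n \<omega> * X (Suc n) \<omega>)"
    by (rule integrable_cwalk_mult[of _ 1]) (auto simp: abs_X_Suc)
  note ints = int integrable_cwalk integrable_cwalk_sq
  have "expectation (\<lambda>\<omega>. cwalk (Suc n) \<omega> ^ 2)
      \<le> expectation (\<lambda>\<omega>. cwalk n \<omega> ^ 2 + 2 * (cwalk n \<omega> * X (Suc n) \<omega>) - 2 * m * cwalk n \<omega> + 4)"
  proof (rule integral_mono)
    fix \<omega> assume "\<omega> \<in> space P"
    then have "(X (Suc n) \<omega> - m) ^ 2 \<le> 2 ^ 2"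
      unfolding m_def by (subst abs_le_square_iff[symmetric]) (use abs_centered_X_le in simp)
    then show "cwalk (Suc n) \<omega> ^ 2
        \<le> cwalk n \<omega> ^ 2 + 2 * (cwalk n \<omega> * X (Suc n) \<omega>) - 2 * m * cwalk n \<omega> + 4"
      by (simp add: cwalk_Suc m_def[symmetric] power2_eq_square algebra_simps)
  qed (use ints in auto)
  also have "\<dots> = expectation (\<lambda>\<omega>. cwalk n \<omega> ^ 2) + 2 * expectation (\<lambda>\<omega>. cwalk n \<omega> * X (Suc n) \<omega>) + 4"
    using ints by (simp add: expectation_cwalk prob_space)
  finally show ?thesis
    unfolding expectation_cwalk_mult_X[OF n] by (simp add: algebra_simps)
qed

section \<open>Almost sure convergence of the normalised walk\<close>

text \<open>The difference is a centred increment minus the old ratio, over \<open>n + 1\<close>;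
  both are at most 2 in absolute value.\<close>

lemma abs_cwalk_ratio_diff_le:
  assumes \<omega>: "\<omega> \<in> space P" and n: "n \<ge> 1"
  shows "\<bar>cwalk (Suc n) \<omega> / real (Suc n) - cwalk n \<omega> / real n\<bar> \<le> 4 / real n"
proof -
  let ?Y = "X (Suc n) \<omega> - expectation (X (Suc n))"
  have "cwalk (Suc n) \<omega> / real (Suc n) - cwalk n \<omega> / real n
      = (?Y - cwalk n \<omega> / real n) / real (Suc n)"
    using n unfolding cwalk_Suc by (simp add: field_simps)
  moreover have "\<bar>cwalk n \<omega> / real n\<bar> \<le> 2"
    using abs_cwalk_le[OF \<omega>, of n] n by (simp add: field_simps)
  then have "\<bar>?Y - cwalk n \<omega> / real n\<bar> \<le> 4"
    using abs_centered_X_le[OF \<omega>, of n] by linarith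
  then have "\<bar>(?Y - cwalk n \<omega> / real n) / real (Suc n)\<bar> \<le> 4 / real n"
    unfolding abs_divide using n by (intro frac_le) auto
  ultimately show ?thesis by simp
qed

lemma cwalk_ratio_tendsto_zero:
  assumes c: "0 \<le> c" "c < 1" and drift: "\<And>n. n \<ge> N \<Longrightarrow> g (\<alpha>, n) * (2 * p - 1) \<le> c"
  shows "AE \<omega> in P. (\<lambda>n. cwalk n \<omega> / real n) \<longlonglongrightarrow> 0"
proof -
  let ?V = "\<lambda>n. expectation (\<lambda>\<omega>. cwalk n \<omega> ^ 2)"
  have "summable (\<lambda>n. ?V n / real n ^ 3)"
  \<comment> \<open>Starting at \<open>Suc N\<close> guarantees \<open>n\<close> at least 1 for
    \<open>second_moment_step\<close> and puts \<open>Suc n\<close> in the range of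
    \<open>drift\<close>.\<close>
  proof (rule summable_of_recursive_bound[OF c, of _ 4 "Suc N"])
    fix n assume n: "n \<ge> Suc N"
    have "?V (Suc n) \<le> (1 + 2 * (g (\<alpha>, Suc n) * (2 * p - 1)) / real n) * ?V n + 4"
      using n by (intro second_moment_step) simp
    also have "\<dots> \<le> (1 + 2 * c / real n) * ?V n + 4"
      using drift[of "Suc n"] n
      by (intro add_right_mono mult_right_mono add_left_mono divide_right_mono mult_left_mono) auto
    finally show "?V (Suc n) \<le> (1 + 2 * c / real n) * ?V n + 4" .
  qed auto
  then have "AE \<omega> in P. summable (\<lambda>n. cwalk n \<omega> ^ 2 / real n ^ 3)"
    by (intro AE_summable_of_summable_expectation) (auto simp: integrable_cwalk_sq)
  with AE_space show ?thesis
  proof eventually_elim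
    case (elim \<omega>)
    \<comment> \<open>This explains the cubic weight: it yields the squares of the ratio with weight
      \<open>1/n\<close>. At \<open>n = 0\<close> both sides are 0.\<close>
    have "cwalk n \<omega> ^ 2 / real n ^ 3 = (cwalk n \<omega> / real n) ^ 2 / real n" for n
      by (simp add: power_divide power2_eq_square power3_eq_cube)
    then show ?case
      using tendsto_zero_of_summable_weighted_squares[of "\<lambda>n. cwalk n \<omega> / real n" 4] elim
        abs_cwalk_ratio_diff_le by simp
  qed
qed

end

theorem theorem1:
  fixes M :: "'a measure" and T :: "'a \<Rightarrow> 'a" and f :: "'a \<Rightarrow> real" and p q :: real
    and R :: "(real \<times> nat) set" and g :: "real \<times> nat \<Rightarrow> real" and \<alpha> :: real
    and x :: 'a and P :: "'w measure" and X :: "nat \<Rightarrow> 'w \<Rightarrow> real"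
  assumes "derw_parameters M T f p q R g \<alpha>"
    and "ereal p * ell_sup g \<alpha> < 1"
    and "x \<in> space M"
    and "derw_increments P T f p q g \<alpha> x X"
  shows "AE \<omega> in P.
    (\<lambda>n. (walk X n \<omega> - prob_space.expectation P (walk X n)) / real n) \<longlonglongrightarrow> 0"
proof -
  interpret D: derw_parameters M T f p q R g \<alpha> by fact
  interpret derw_increments P T f p q g \<alpha> x X by fact
  \<comment> \<open>The range of \<open>g\<close> is known on \<open>R\<close>, which is assumed to
    contain \<open>(\<alpha>, n)\<close> from \<open>n = 1\<close> on.\<close>
  have "0 \<le> g (\<alpha>, n) \<and> g (\<alpha>, n) \<le> 1" if "n \<ge> 1" for n
    using D.g D.\<alpha>[OF that] by auto
  then obtain c N where "0 \<le> c" "c < 1" "\<And>n. n \<ge> N \<Longrightarrow> g (\<alpha>, n) * (2 * p - 1) \<le> c"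
    using drift_bound[of p "\<lambda>n. g (\<alpha>, n)"] D.p assms(2) unfolding ell_sup_def by auto
  from cwalk_ratio_tendsto_zero[OF this] show ?thesis
    unfolding cwalk_def .
qed

end
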